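(* Assume that $U$ has the Whitney property. Then every map $u\in BV([a,b];U)$ is the pointwise limit (at every point of $[a,b]$) of a sequence $(u_k)$ of absolutely continuous maps $u_k:[a,b]\to U$ with equibounded variation.
   Context: $[a,b]$ is a compact interval. $BV([a,b];U)$ is the set of (everywhere defined) maps $[a,b]\to U$ of bounded total variation; $\mathrm{Var}_I(h)$ is the total variation of $h$ on $I$; "equibounded variation" means $\sup_k \mathrm{Var}_{[a,b]}(u_k)<\infty$. Standing hypothesis on $U$: $U\subset\mathbb{R}^m$ is compact and such that for every bounded interval $I\subset\mathbb{R}$, each $\tau\in I$ and every pointwise defined Lebesgue integrable $w:I\to U$ there is a sequence $(w_k^\tau)$ of absolutely continuous maps from $I$ to $U$ with $|w_k^\tau(\tau)-w(\tau)|+\|w_k^\tau-w\|_1\to0$, where $\|\cdot\|_1$ is the $L^1$-norm. Whitney property. A compact set $U\subset\mathbb{R}^m$ has the Whitney property if there is $M\ge1$ such that for every $(u_1,u_2)\in U\times U$ there is an absolutely continuous path $\gamma:[0,1]\to U$ with $\gamma(0)=u_1$, $\gamma(1)=u_2$ and $\mathrm{Var}_{[0,1]}(\gamma)\le M|u_1-u_2|$. *)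

theory Defs
  imports "HOL-Analysis.Analysis"
begin

text \<open>
  Maps defined on an interval \<open>I\<close> are total functions on \<open>real\<close> whose values outside \<open>I\<close>
  are never looked at by the notions below.
\<close>

definition total_variation :: "real set \<Rightarrow> (real \<Rightarrow> 'a::real_normed_vector) \<Rightarrow> ennreal" where
  "total_variation I h =
     (SUP (n, t) \<in> {(n::nat, t). mono_on {..n} t \<and> t ` {..n} \<subseteq> I}.
        ennreal (\<Sum>i<n. norm (h (t (Suc i)) - h (t i))))"

definition BV :: "real set \<Rightarrow> 'a::real_normed_vector set \<Rightarrow> (real \<Rightarrow> 'a) set" where
  "BV I U = {u. u \<in> I \<rightarrow> U \<and> total_variation I u < \<infinity>}"

text \<open>
  The usual definition with finite families of non-overlapping subintervals. It is meant for
  intervals \<open>I\<close>, where \<open>s i, t i \<in> I\<close> makes \<open>[s i, t i]\<close> a subinterval of \<open>I\<close>.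
  It is unrelated to the library's \<open>absolutely_continuous\<close>, which is a relation between measures.
\<close>

definition absolutely_continuous_on :: "real set \<Rightarrow> (real \<Rightarrow> 'a::real_normed_vector) \<Rightarrow> bool" where
  "absolutely_continuous_on I h \<longleftrightarrow>
     (\<forall>\<epsilon>>0. \<exists>\<delta>>0. \<forall>(n::nat) s t.
        (\<forall>i<n. s i \<in> I \<and> t i \<in> I \<and> s i \<le> t i) \<and>
        disjoint_family_on (\<lambda>i. {s i<..<t i}) {..<n} \<and>
        (\<Sum>i<n. t i - s i) < \<delta> \<longrightarrow>
        (\<Sum>i<n. norm (h (t i) - h (s i))) < \<epsilon>)"

definition pointwise_L1_ac_approximable :: "(real ^ 'm) set \<Rightarrow> bool" where
  "pointwise_L1_ac_approximable U \<longleftrightarrow>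
     (\<forall>I \<tau> w. is_interval I \<and> bounded I \<and> \<tau> \<in> I \<and>
        w \<in> I \<rightarrow> U \<and> set_integrable lebesgue I w \<longrightarrow>
        (\<exists>wk :: nat \<Rightarrow> real \<Rightarrow> real ^ 'm.
           (\<forall>k. wk k \<in> I \<rightarrow> U \<and> absolutely_continuous_on I (wk k)) \<and>
           (\<lambda>k. norm (wk k \<tau> - w \<tau>) + (LINT t:I|lebesgue. norm (wk k t - w t)))
             \<longlonglongrightarrow> 0))"

definition whitney_property :: "(real ^ 'm) set \<Rightarrow> bool" where
  "whitney_property U \<longleftrightarrow> compact U \<and>
     (\<exists>M\<ge>1. \<forall>u1\<in>U. \<forall>u2\<in>U. \<exists>\<gamma>.
        \<gamma> \<in> {0..1} \<rightarrow> U \<and> absolutely_continuous_on {0..1} \<gamma> \<and>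
        \<gamma> 0 = u1 \<and> \<gamma> 1 = u2 \<and>
        total_variation {0..1} \<gamma> \<le> ennreal (M * norm (u1 - u2)))"

end

theory Submission
  imports Defs
begin

text \<open>
  Let \<open>v\<close> be the variation function of \<open>u\<close>, and let \<open>D\<close> be a countable dense subset of
  \<open>[a, b]\<close> that contains \<open>a\<close>, \<open>b\<close> and all discontinuities of the monotone function \<open>v\<close>. Exhaust
  \<open>D\<close> by finite sets \<open>F\<^sub>k\<close>, and let \<open>u\<^sub>k\<close> agree with \<open>u\<close> on \<open>F\<^sub>k\<close> and follow Whitney paths between
  consecutive points of \<open>F\<^sub>k\<close>. Then \<open>Var u\<^sub>k \<le> M Var u\<close>. At points of \<open>D\<close> the sequence is eventually
  constant; at any other \<open>t\<close> the function \<open>v\<close>, hence \<open>u\<close>, is continuous, and the two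
  neighbours of \<open>t\<close> in \<open>F\<^sub>k\<close> converge to \<open>t\<close>.
\<close>

section \<open>Total variation\<close>

lemma total_variation_upper:
  assumes "mono_on {..n} t" "t ` {..n} \<subseteq> I"
  shows "ennreal (\<Sum>i<n. norm (h (t (Suc i)) - h (t i))) \<le> total_variation I h"
  unfolding total_variation_def using assms by (intro SUP_upper2[of "(n, t)"]) auto

lemma total_variation_least:
  assumes "\<And>n t. mono_on {..n} t \<Longrightarrow> t ` {..n} \<subseteq> I \<Longrightarrow>
             ennreal (\<Sum>i<n. norm (h (t (Suc i)) - h (t i))) \<le> c"
  shows "total_variation I h \<le> c"
  unfolding total_variation_def using assms by (intro SUP_least) auto

lemma norm_diff_le_total_variation:
  assumes "x \<in> I" "y \<in> I" "x \<le> y"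
  shows "ennreal (norm (h y - h x)) \<le> total_variation I h"
proof -
  have "ennreal (\<Sum>i<1. norm (h ((\<lambda>i. if i = (0::nat) then x else y) (Suc i))
          - h ((\<lambda>i. if i = 0 then x else y) i))) \<le> total_variation I h"
    using assms by (intro total_variation_upper) (auto simp: mono_on_def)
  then show ?thesis by simp
qed

text \<open>Partition points may repeat, so a weakly increasing \<open>f\<close> turns every
  partition of \<open>J\<close> into one of \<open>I\<close> with the same sum. This serves both for
  affine changes of parameter and, with \<open>f\<close> the identity, for restriction to a
  subset.\<close>

lemma total_variation_compose_mono:
  assumes "mono_on J f" "f ` J \<subseteq> I"
  shows "total_variation J (\<lambda>x. h (f x)) \<le> total_variation I h"
proof (rule total_variation_least)
  fix n and t :: "nat \<Rightarrow> real"
  assume "mono_on {..n} t" "t ` {..n} \<subseteq> J"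
  with assms have "mono_on {..n} (\<lambda>i. f (t i))" "(\<lambda>i. f (t i)) ` {..n} \<subseteq> I"
    by (force simp: mono_on_def image_subset_iff)+
  then show "ennreal (\<Sum>i<n. norm (h (f (t (Suc i))) - h (f (t i)))) \<le> total_variation I h"
    by (rule total_variation_upper)
qed

lemma total_variation_mono:
  assumes "J \<subseteq> I"
  shows "total_variation J h \<le> total_variation I h"
  using total_variation_compose_mono[of J "\<lambda>x. x" I h] assms by (simp add: mono_on_def)

lemma total_variation_cong:
  assumes "\<And>x. x \<in> I \<Longrightarrow> g x = h x"
  shows "total_variation I g = total_variation I h"
proof -
  have "total_variation I g \<le> total_variation I h" if "\<And>x. x \<in> I \<Longrightarrow> g x = h x" for g h :: "real \<Rightarrow> 'a"
  proof (rule total_variation_least)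
    fix n and t :: "nat \<Rightarrow> real"
    assume t: "mono_on {..n} t" "t ` {..n} \<subseteq> I"
    have "(\<Sum>i<n. norm (g (t (Suc i)) - g (t i))) = (\<Sum>i<n. norm (h (t (Suc i)) - h (t i)))"
      using t(2) that by (intro sum.cong) (auto simp: image_subset_iff)
    then show "ennreal (\<Sum>i<n. norm (g (t (Suc i)) - g (t i))) \<le> total_variation I h"
      using total_variation_upper[OF t, of h] by simp
  qed
  from this[of g h] this[of h g] show ?thesis using assms by (simp add: antisym)
qed

text \<open>The increment of \<open>h\<close> is the sum of its two clamped increments: if
  \<open>x\<close> and \<open>y\<close> lie on the same side of \<open>b\<close>, one of them
  vanishes; otherwise \<open>h b\<close> is inserted and cancels. Clamping splits a family of
  intervals at \<open>b\<close> without locating the interval that contains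
  \<open>b\<close>.\<close>

lemma norm_diff_le_clamped:
  fixes h :: "real \<Rightarrow> 'a::real_normed_vector"
  assumes "x \<le> y"
  shows "norm (h y - h x) \<le> norm (h (min y b) - h (min x b)) + norm (h (max y b) - h (max x b))"
proof -
  have "h y - h x = (h (min y b) - h (min x b)) + (h (max y b) - h (max x b))"
    using assms by (auto simp: min_def max_def)
  then show ?thesis by (metis norm_triangle_ineq)
qed

text \<open>For a partition \<open>t\<close> of the whole interval, \<open>min (t i) b\<close> and
  \<open>max (t i) b\<close> are partitions of the two halves, and their sums together dominate the
  sum for \<open>t\<close>.\<close>

lemma total_variation_join:
  assumes "a \<le> b" "b \<le> c"
  shows "total_variation {a..c} h \<le> total_variation {a..b} h + total_variation {b..c} h"
proof (rule total_variation_least)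
  fix n and t :: "nat \<Rightarrow> real"
  assume t: "mono_on {..n} t" "t ` {..n} \<subseteq> {a..c}"
  let ?S = "\<lambda>f. \<Sum>i<n. norm (h (f (t (Suc i))) - h (f (t i)))"
  have "(\<Sum>i<n. norm (h (t (Suc i)) - h (t i))) \<le> ?S (\<lambda>x. min x b) + ?S (\<lambda>x. max x b)"
    unfolding sum.distrib[symmetric] using t(1)
    by (intro sum_mono norm_diff_le_clamped) (auto simp: mono_on_def)
  then have "ennreal (\<Sum>i<n. norm (h (t (Suc i)) - h (t i)))
      \<le> ennreal (?S (\<lambda>x. min x b)) + ennreal (?S (\<lambda>x. max x b))"
    by (simp add: sum_nonneg ennreal_leI flip: ennreal_plus)
  also have "\<dots> \<le> total_variation {a..b} h + total_variation {b..c} h"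
  proof (intro add_mono total_variation_upper)
    show "mono_on {..n} (\<lambda>i. min (t i) b)" "mono_on {..n} (\<lambda>i. max (t i) b)"
      using t(1) by (force simp: mono_on_def min_def max_def)+
  qed (use t(2) assms in \<open>auto simp: image_subset_iff\<close>)
  finally show "ennreal (\<Sum>i<n. norm (h (t (Suc i)) - h (t i)))
      \<le> total_variation {a..b} h + total_variation {b..c} h" .
qed

text \<open>Each partition of \<open>{a..b}\<close> extends to one of \<open>{a..c}\<close> by
  appending \<open>b\<close> and \<open>c\<close>. This is the part of superadditivity that is used
  twice: for the monotonicity of the variation function, and to pay for one more Whitney
  path.\<close>

lemma total_variation_add_increment_le:
  assumes "a \<le> b" "b \<le> c"
  shows "total_variation {a..b} h + ennreal (norm (h c - h b)) \<le> total_variation {a..c} h"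
proof -
  let ?T = "{(n::nat, t). mono_on {..n} t \<and> t ` {..n} \<subseteq> {a..b}}"
  \<comment> \<open>Moving a constant into a supremum requires a nonempty index set; the one-point
    partition at \<open>a\<close> is a member.\<close>
  have ne: "?T \<noteq> {}"
  proof -
    have "(0, \<lambda>_. a) \<in> ?T" using assms by (simp add: mono_on_def)
    then show ?thesis by blast
  qed
  have step: "ennreal (\<Sum>i<n. norm (h (t (Suc i)) - h (t i))) + ennreal (norm (h c - h b))
      \<le> total_variation {a..c} h" if t: "mono_on {..n} t" "t ` {..n} \<subseteq> {a..b}" for n and t :: "nat \<Rightarrow> real"
  proof -
    \<comment> \<open>The term with index \<open>n\<close> bridges \<open>t n\<close> and
      \<open>b\<close> and is dropped as nonnegative; the term with index \<open>Suc n\<close> is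
      the required increment from \<open>b\<close> to \<open>c\<close>.\<close>
    define s where "s i = (if i \<le> n then t i else if i = Suc n then b else c)" for i
    have tb: "a \<le> t i" "t i \<le> b" if "i \<le> n" for i using t(2) that by auto
    have "mono_on {..Suc (Suc n)} s"
      using t(1) tb assms by (force simp: mono_on_def s_def)
    moreover have "s ` {..Suc (Suc n)} \<subseteq> {a..c}"
      using tb assms by (force simp: s_def)
    ultimately have "ennreal (\<Sum>i<Suc (Suc n). norm (h (s (Suc i)) - h (s i))) \<le> total_variation {a..c} h"
      by (rule total_variation_upper)
    moreover have "(\<Sum>i<n. norm (h (s (Suc i)) - h (s i))) = (\<Sum>i<n. norm (h (t (Suc i)) - h (t i)))"
      by (intro sum.cong) (auto simp: s_def)
    then have "(\<Sum>i<n. norm (h (t (Suc i)) - h (t i))) + norm (h c - h b)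
       \<le> (\<Sum>i<Suc (Suc n). norm (h (s (Suc i)) - h (s i)))"
      by (simp add: s_def)
    then have "ennreal (\<Sum>i<n. norm (h (t (Suc i)) - h (t i))) + ennreal (norm (h c - h b))
       \<le> ennreal (\<Sum>i<Suc (Suc n). norm (h (s (Suc i)) - h (s i)))"
      by (simp only: ennreal_leI sum_nonneg norm_ge_zero flip: ennreal_plus)
    ultimately show ?thesis by (rule order_trans[rotated])
  qed
  have "total_variation {a..b} h + ennreal (norm (h c - h b)) =
    (SUP x\<in>?T. (case x of (n, t) \<Rightarrow> ennreal (\<Sum>i<n. norm (h (t (Suc i)) - h (t i)))) + ennreal (norm (h c - h b)))"
    unfolding total_variation_def by (rule ennreal_SUP_add_left[OF ne, symmetric])
  also have "\<dots> \<le> total_variation {a..c} h"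
    by (rule SUP_least) (use step in auto)
  finally show ?thesis .
qed

section \<open>The variation function and its discontinuities\<close>

text \<open>The witness is the variation of \<open>u\<close> on \<open>{a..s}\<close> as a function
  of \<open>s\<close>. It is monotone, hence has countably many discontinuities, and it dominates
  the increments of \<open>u\<close>, so \<open>u\<close> is continuous wherever it is.\<close>

lemma countable_discontinuities_variation_function:
  assumes "total_variation {a..b} u < \<infinity>"
  obtains v :: "real \<Rightarrow> real" where
    "countable {t \<in> {a..b}. \<not> continuous (at t within {a..b}) v}"
    "\<And>s t. s \<in> {a..b} \<Longrightarrow> t \<in> {a..b} \<Longrightarrow> norm (u t - u s) \<le> \<bar>v t - v s\<bar>"
proof -
  define v where "v s = enn2real (total_variation {a..s} u)" for s
  \<comment> \<open>Finite variation on \<open>{a..b}\<close> ensures that passing to the reals by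
    \<open>enn2real\<close> loses nothing.\<close>
  have v: "ennreal (v s) = total_variation {a..s} u" if "s \<le> b" for s
    using total_variation_mono[of "{a..s}" "{a..b}" u] assms that
    unfolding v_def by (intro ennreal_enn2real) auto
  have v0: "0 \<le> v s" for s by (simp add: v_def)
  have "norm (u t - u s) \<le> v t - v s" if "a \<le> s" "s \<le> t" "t \<le> b" for s t
  proof -
    have "ennreal (v s + norm (u t - u s)) \<le> ennreal (v t)"
      using total_variation_add_increment_le[of a s t u] v[of s] v[of t] that v0[of s] by simp
    then show ?thesis using v0[of t] by (simp add: ennreal_le_iff)
  qed
  note inc = this
  have "mono_on {a..b} v"
  proof (rule mono_onI)
    fix s t
    assume "s \<in> {a..b}" "t \<in> {a..b}" "s \<le> t"
    then have "norm (u t - u s) \<le> v t - v s" using inc by simp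
    then show "v s \<le> v t" using norm_ge_zero[of "u t - u s"] by linarith
  qed
  then have "countable {t \<in> {a..b}. \<not> continuous (at t within {a..b}) v}"
    by (rule mono_on_ctble_discont)
  moreover have "norm (u t - u s) \<le> \<bar>v t - v s\<bar>" if "s \<in> {a..b}" "t \<in> {a..b}" for s t
    using inc[of s t] inc[of t s] that by (cases "s \<le> t") (auto simp: norm_minus_commute)
  ultimately show thesis by (rule that)
qed

section \<open>Absolutely continuous interpolation\<close>

lemma absolutely_continuous_onD:
  assumes "absolutely_continuous_on I h" "\<epsilon> > 0"
  obtains \<delta> where "\<delta> > 0"
    "\<And>(n::nat) s t. (\<And>i. i < n \<Longrightarrow> s i \<in> I \<and> t i \<in> I \<and> s i \<le> t i) \<Longrightarrow>
        disjoint_family_on (\<lambda>i. {s i<..<t i}) {..<n} \<Longrightarrow>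
        (\<Sum>i<n. t i - s i) < \<delta> \<Longrightarrow> (\<Sum>i<n. norm (h (t i) - h (s i))) < \<epsilon>"
proof -
  from assms obtain \<delta> where "\<delta> > 0" and \<delta>: "\<forall>(n::nat) s t.
        (\<forall>i<n. s i \<in> I \<and> t i \<in> I \<and> s i \<le> t i) \<and>
        disjoint_family_on (\<lambda>i. {s i<..<t i}) {..<n} \<and> (\<Sum>i<n. t i - s i) < \<delta> \<longrightarrow>
        (\<Sum>i<n. norm (h (t i) - h (s i))) < \<epsilon>"
    unfolding absolutely_continuous_on_def by blast
  show thesis
    by (rule that[OF \<open>\<delta> > 0\<close>], rule \<delta>[rule_format]) simp
qed

lemma absolutely_continuous_onI:
  assumes "\<And>\<epsilon>. \<epsilon> > 0 \<Longrightarrow> \<exists>\<delta>>0. \<forall>(n::nat) s t.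
        (\<forall>i<n. s i \<in> I \<and> t i \<in> I \<and> s i \<le> t i) \<longrightarrow>
        disjoint_family_on (\<lambda>i. {s i<..<t i}) {..<n} \<longrightarrow>
        (\<Sum>i<n. t i - s i) < \<delta> \<longrightarrow> (\<Sum>i<n. norm (h (t i) - h (s i))) < \<epsilon>"
  shows "absolutely_continuous_on I h"
  unfolding absolutely_continuous_on_def imp_conjL using assms by blast

lemma absolutely_continuous_on_cong:
  assumes "absolutely_continuous_on I g" "\<And>x. x \<in> I \<Longrightarrow> h x = g x"
  shows "absolutely_continuous_on I h"
proof (rule absolutely_continuous_onI)
  fix \<epsilon> :: real
  assume "\<epsilon> > 0"
  with assms(1) obtain \<delta> where \<delta>: "\<delta> > 0"
    "\<And>(n::nat) s t. (\<And>i. i < n \<Longrightarrow> s i \<in> I \<and> t i \<in> I \<and> s i \<le> t i) \<Longrightarrow>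
        disjoint_family_on (\<lambda>i. {s i<..<t i}) {..<n} \<Longrightarrow>
        (\<Sum>i<n. t i - s i) < \<delta> \<Longrightarrow> (\<Sum>i<n. norm (g (t i) - g (s i))) < \<epsilon>"
    using absolutely_continuous_onD by blast
  have "(\<Sum>i<n. norm (h (t i) - h (s i))) = (\<Sum>i<n. norm (g (t i) - g (s i)))"
    if "\<forall>i<n. s i \<in> I \<and> t i \<in> I \<and> s i \<le> t i" for n :: nat and s t
    using that assms(2) by (intro sum.cong) auto
  then show "\<exists>\<delta>>0. \<forall>(n::nat) s t.
        (\<forall>i<n. s i \<in> I \<and> t i \<in> I \<and> s i \<le> t i) \<longrightarrow>
        disjoint_family_on (\<lambda>i. {s i<..<t i}) {..<n} \<longrightarrow>
        (\<Sum>i<n. t i - s i) < \<delta> \<longrightarrow> (\<Sum>i<n. norm (h (t i) - h (s i))) < \<epsilon>"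
    using \<delta> by (intro exI[of _ \<delta>]) auto
qed

text \<open>A family of intervals is clamped at \<open>b\<close> from both sides. Clamping keeps the
  family disjoint and does not lengthen its members, so the smaller of the two
  \<open>\<delta>\<close> for \<epsilon>/2 works for the glued interval.\<close>

lemma absolutely_continuous_on_join:
  assumes "absolutely_continuous_on {a..b} h" "absolutely_continuous_on {b..c} h" "a \<le> b" "b \<le> c"
  shows "absolutely_continuous_on {a..c} h"
proof (rule absolutely_continuous_onI)
  fix \<epsilon> :: real
  assume "\<epsilon> > 0"
  then have "\<epsilon> / 2 > 0" by simp
  from absolutely_continuous_onD[OF assms(1) this] obtain \<delta>1 where \<delta>1: "\<delta>1 > 0"
    "\<And>(n::nat) s t. (\<And>i. i < n \<Longrightarrow> s i \<in> {a..b} \<and> t i \<in> {a..b} \<and> s i \<le> t i) \<Longrightarrow>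
        disjoint_family_on (\<lambda>i. {s i<..<t i}) {..<n} \<Longrightarrow>
        (\<Sum>i<n. t i - s i) < \<delta>1 \<Longrightarrow> (\<Sum>i<n. norm (h (t i) - h (s i))) < \<epsilon> / 2"
    by blast
  from absolutely_continuous_onD[OF assms(2) \<open>\<epsilon> / 2 > 0\<close>] obtain \<delta>2 where \<delta>2: "\<delta>2 > 0"
    "\<And>(n::nat) s t. (\<And>i. i < n \<Longrightarrow> s i \<in> {b..c} \<and> t i \<in> {b..c} \<and> s i \<le> t i) \<Longrightarrow>
        disjoint_family_on (\<lambda>i. {s i<..<t i}) {..<n} \<Longrightarrow>
        (\<Sum>i<n. t i - s i) < \<delta>2 \<Longrightarrow> (\<Sum>i<n. norm (h (t i) - h (s i))) < \<epsilon> / 2"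
    by blast
  have "(\<Sum>i<n. norm (h (t i) - h (s i))) < \<epsilon>"
    if st: "\<forall>i<n. s i \<in> {a..c} \<and> t i \<in> {a..c} \<and> s i \<le> t i"
      and dis: "disjoint_family_on (\<lambda>i. {s i<..<t i}) {..<n}"
      and len: "(\<Sum>i<n. t i - s i) < min \<delta>1 \<delta>2" for n :: nat and s t
  proof -
    have "(\<Sum>i<n. norm (h (min (t i) b) - h (min (s i) b))) < \<epsilon> / 2"
    proof (rule \<delta>1(2))
      \<comment> \<open>A point strictly between the clamped ends lies below \<open>b\<close>, hence
        strictly between the original ends; disjointness is thus inherited.\<close>
      show "disjoint_family_on (\<lambda>i. {min (s i) b<..<min (t i) b}) {..<n}"
        using dis by (rule disjoint_family_on_bisimulation) force
      have "(\<Sum>i<n. min (t i) b - min (s i) b) \<le> (\<Sum>i<n. t i - s i)"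
        using st by (intro sum_mono) (auto simp: min_def)
      then show "(\<Sum>i<n. min (t i) b - min (s i) b) < \<delta>1" using len by simp
    qed (use st assms in \<open>auto simp: min_def\<close>)
    moreover have "(\<Sum>i<n. norm (h (max (t i) b) - h (max (s i) b))) < \<epsilon> / 2"
    proof (rule \<delta>2(2))
      show "disjoint_family_on (\<lambda>i. {max (s i) b<..<max (t i) b}) {..<n}"
        using dis by (rule disjoint_family_on_bisimulation) force
      have "(\<Sum>i<n. max (t i) b - max (s i) b) \<le> (\<Sum>i<n. t i - s i)"
        using st by (intro sum_mono) (auto simp: max_def)
      then show "(\<Sum>i<n. max (t i) b - max (s i) b) < \<delta>2" using len by simp
    qed (use st assms in \<open>auto simp: max_def\<close>)
    moreover have "(\<Sum>i<n. norm (h (t i) - h (s i))) \<le>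
        (\<Sum>i<n. norm (h (min (t i) b) - h (min (s i) b))) + (\<Sum>i<n. norm (h (max (t i) b) - h (max (s i) b)))"
      unfolding sum.distrib[symmetric] using st by (intro sum_mono norm_diff_le_clamped) auto
    ultimately show ?thesis by simp
  qed
  then show "\<exists>\<delta>>0. \<forall>(n::nat) s t.
        (\<forall>i<n. s i \<in> {a..c} \<and> t i \<in> {a..c} \<and> s i \<le> t i) \<longrightarrow>
        disjoint_family_on (\<lambda>i. {s i<..<t i}) {..<n} \<longrightarrow>
        (\<Sum>i<n. t i - s i) < \<delta> \<longrightarrow> (\<Sum>i<n. norm (h (t i) - h (s i))) < \<epsilon>"
    using \<delta>1(1) \<delta>2(1) by (intro exI[of _ "min \<delta>1 \<delta>2"]) auto
qed

text \<open>The affine map onto \<open>{0..1}\<close> divides all lengths by \<open>q - p\<close>,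
  so \<open>\<delta> * (q - p)\<close> is the threshold on \<open>{p..q}\<close>.\<close>

lemma absolutely_continuous_on_rescale:
  assumes "absolutely_continuous_on {0..1} h" "p < q"
  shows "absolutely_continuous_on {p..q} (\<lambda>x. h ((x - p) / (q - p)))"
proof (rule absolutely_continuous_onI)
  fix \<epsilon> :: real
  assume "\<epsilon> > 0"
  from absolutely_continuous_onD[OF assms(1) this] obtain \<delta> where \<delta>: "\<delta> > 0"
    "\<And>(n::nat) s t. (\<And>i. i < n \<Longrightarrow> s i \<in> {0..1} \<and> t i \<in> {0..1} \<and> s i \<le> t i) \<Longrightarrow>
        disjoint_family_on (\<lambda>i. {s i<..<t i}) {..<n} \<Longrightarrow>
        (\<Sum>i<n. t i - s i) < \<delta> \<Longrightarrow> (\<Sum>i<n. norm (h (t i) - h (s i))) < \<epsilon>"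
    by blast
  define f where "f x = (x - p) / (q - p)" for x
  have "(\<Sum>i<n. norm (h (f (t i)) - h (f (s i)))) < \<epsilon>"
    if st: "\<forall>i<n. s i \<in> {p..q} \<and> t i \<in> {p..q} \<and> s i \<le> t i"
      and dis: "disjoint_family_on (\<lambda>i. {s i<..<t i}) {..<n}"
      and len: "(\<Sum>i<n. t i - s i) < \<delta> * (q - p)" for n :: nat and s t
  proof (rule \<delta>(2))
    show "f (s i) \<in> {0..1} \<and> f (t i) \<in> {0..1} \<and> f (s i) \<le> f (t i)" if "i < n" for i
      using st that assms(2) by (auto simp: f_def divide_simps)
    \<comment> \<open>The inverse affine map carries a common point of two image intervals back to a
      common point of the original ones, which are disjoint.\<close>
    have sub: "p + x * (q - p) \<in> {c<..<d}" if "x \<in> {f c<..<f d}" for x c d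
      using that assms(2) by (auto simp: f_def field_simps)
    show "disjoint_family_on (\<lambda>i. {f (s i)<..<f (t i)}) {..<n}"
      unfolding disjoint_family_on_def
    proof (intro ballI impI)
      fix i j
      assume ij: "i \<in> {..<n}" "j \<in> {..<n}" "i \<noteq> j"
      then have "{s i<..<t i} \<inter> {s j<..<t j} = {}"
        using dis by (auto simp only: disjoint_family_on_def)
      then show "{f (s i)<..<f (t i)} \<inter> {f (s j)<..<f (t j)} = {}"
        using sub by blast
    qed
    have "(\<Sum>i<n. f (t i) - f (s i)) = (\<Sum>i<n. t i - s i) / (q - p)"
      unfolding sum_divide_distrib by (intro sum.cong) (auto simp: f_def diff_divide_distrib)
    then show "(\<Sum>i<n. f (t i) - f (s i)) < \<delta>"
      using len assms(2) by (simp add: pos_divide_less_eq)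
  qed
  then show "\<exists>\<delta>>0. \<forall>(n::nat) s t.
        (\<forall>i<n. s i \<in> {p..q} \<and> t i \<in> {p..q} \<and> s i \<le> t i) \<longrightarrow>
        disjoint_family_on (\<lambda>i. {s i<..<t i}) {..<n} \<longrightarrow>
        (\<Sum>i<n. t i - s i) < \<delta> \<longrightarrow>
        (\<Sum>i<n. norm (h ((t i - p) / (q - p)) - h ((s i - p) / (q - p)))) < \<epsilon>"
    using \<delta>(1) assms(2) unfolding f_def by (intro exI[of _ "\<delta> * (q - p)"]) auto
qed

section \<open>Whitney paths and interpolation at finitely many nodes\<close>

text \<open>Affine reparametrization does not increase variation, so one constant \<open>M\<close>
  serves for parameter intervals of every length.\<close>

lemma whitney_path:
  assumes "whitney_property U"
  obtains M where "M \<ge> 1" and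
    "\<And>u1 u2 p q. u1 \<in> U \<Longrightarrow> u2 \<in> U \<Longrightarrow> p < q \<Longrightarrow>
      \<exists>g. g \<in> {p..q} \<rightarrow> U \<and> absolutely_continuous_on {p..q} g \<and> g p = u1 \<and> g q = u2 \<and>
          total_variation {p..q} g \<le> ennreal (M * norm (u2 - u1))"
proof -
  from assms obtain M where M: "M \<ge> 1" "\<forall>u1\<in>U. \<forall>u2\<in>U. \<exists>\<gamma>.
        \<gamma> \<in> {0..1} \<rightarrow> U \<and> absolutely_continuous_on {0..1} \<gamma> \<and>
        \<gamma> 0 = u1 \<and> \<gamma> 1 = u2 \<and>
        total_variation {0..1} \<gamma> \<le> ennreal (M * norm (u1 - u2))"
    unfolding whitney_property_def by blast
  show thesis
  proof (rule that[OF M(1)])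
    fix u1 u2 :: "real ^ 'a" and p q :: real
    assume u: "u1 \<in> U" "u2 \<in> U" and pq: "p < q"
    from M(2) u obtain \<gamma> where \<gamma>: "\<gamma> \<in> {0..1} \<rightarrow> U" "absolutely_continuous_on {0..1} \<gamma>"
      "\<gamma> 0 = u1" "\<gamma> 1 = u2" "total_variation {0..1} \<gamma> \<le> ennreal (M * norm (u1 - u2))"
      by blast
    define f where "f x = (x - p) / (q - p)" for x
    have f: "mono_on {p..q} f" "f ` {p..q} \<subseteq> {0..1}" "f p = 0" "f q = 1"
      using pq by (auto simp: f_def mono_on_def divide_simps)
    have "(\<lambda>x. \<gamma> (f x)) \<in> {p..q} \<rightarrow> U" using \<gamma>(1) f(2) by blast
    moreover have "absolutely_continuous_on {p..q} (\<lambda>x. \<gamma> (f x))"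
      unfolding f_def by (rule absolutely_continuous_on_rescale[OF \<gamma>(2) pq])
    moreover have "total_variation {p..q} (\<lambda>x. \<gamma> (f x)) \<le> ennreal (M * norm (u2 - u1))"
      using total_variation_compose_mono[OF f(1,2), of \<gamma>] \<gamma>(5)
      by (simp add: norm_minus_commute)
    ultimately show "\<exists>g. g \<in> {p..q} \<rightarrow> U \<and> absolutely_continuous_on {p..q} g \<and> g p = u1 \<and> g q = u2 \<and>
          total_variation {p..q} g \<le> ennreal (M * norm (u2 - u1))"
      using f(3,4) \<gamma>(3,4) by (intro exI[of _ "\<lambda>x. \<gamma> (f x)"]) simp
  qed
qed

text \<open>Nodes are added in increasing order, each joined to the previous maximum by a Whitney
  path. The cost of a path is \<open>M\<close> times an increment of \<open>u\<close>, which the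
  growth of the variation of \<open>u\<close> absorbs. The last clause locates \<open>h t\<close>:
  it is close to \<open>u\<close> at a node \<open>x\<close> left of \<open>t\<close> as soon as
  \<open>u\<close> varies little between the neighbouring nodes \<open>x\<close> and
  \<open>y\<close>. Pointwise convergence rests on it.\<close>

lemma whitney_interpolation:
  assumes "M \<ge> 1" and path: "\<And>u1 u2 p q. u1 \<in> U \<Longrightarrow> u2 \<in> U \<Longrightarrow> p < q \<Longrightarrow>
      \<exists>g. g \<in> {p..q} \<rightarrow> U \<and> absolutely_continuous_on {p..q} g \<and> g p = u1 \<and> g q = u2 \<and>
          total_variation {p..q} g \<le> ennreal (M * norm (u2 - u1))"
    and "finite F" "F \<noteq> {}" "u \<in> F \<rightarrow> U"
  shows "\<exists>h. h \<in> {Min F..Max F} \<rightarrow> U \<and> absolutely_continuous_on {Min F..Max F} h \<and>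
    (\<forall>t\<in>F. h t = u t) \<and>
    total_variation {Min F..Max F} h \<le> ennreal M * total_variation {Min F..Max F} u \<and>
    (\<forall>t\<in>{Min F..Max F}. \<exists>x\<in>F. \<exists>y\<in>F. x \<le> t \<and> t \<le> y \<and> {x<..<y} \<inter> F = {} \<and>
       norm (h t - u x) \<le> M * norm (u y - u x))"
  using assms(3-)
proof (induction F rule: finite_linorder_max_induct)
  case empty
  then show ?case by simp
next
  case (insert c A)
  show ?case
  proof (cases "A = {}")
    \<comment> \<open>With a single node the interval degenerates to a point, and \<open>u\<close>
      itself is the interpolant.\<close>
    case True
    have "absolutely_continuous_on {c..c} u"
      unfolding absolutely_continuous_on_def by (auto intro!: exI[of _ 1])
    moreover have "total_variation {c..c} u \<le> 0"
    proof (rule total_variation_least)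
      fix n and t :: "nat \<Rightarrow> real"
      assume t: "t ` {..n} \<subseteq> {c..c}"
      then have "t i = c" if "i \<le> n" for i using that by fastforce
      then show "ennreal (\<Sum>i<n. norm (u (t (Suc i)) - u (t i))) \<le> 0" by simp
    qed
    ultimately show ?thesis using True insert.prems by (intro exI[of _ u]) auto
  next
    case False
    let ?m = "Min A" and ?b = "Max A"
    have "u \<in> A \<rightarrow> U" using insert.prems by auto
    from insert.IH[OF False this] obtain h where h: "h \<in> {?m..?b} \<rightarrow> U"
      "absolutely_continuous_on {?m..?b} h" "\<And>t. t \<in> A \<Longrightarrow> h t = u t"
      "total_variation {?m..?b} h \<le> ennreal M * total_variation {?m..?b} u"
      "\<And>t. t \<in> {?m..?b} \<Longrightarrow> \<exists>x\<in>A. \<exists>y\<in>A. x \<le> t \<and> t \<le> y \<and> {x<..<y} \<inter> A = {} \<and>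
         norm (h t - u x) \<le> M * norm (u y - u x)"
      by blast
    have bA: "?b \<in> A" using False insert.hyps(1) by simp
    have bc: "?b < c" using bA insert.hyps(2) by blast
    have mb: "?m \<le> ?b" using False insert.hyps(1) by simp
    have leb: "x \<le> ?b" if "x \<in> A" for x using that insert.hyps(1) by simp
    have mx: "Max (insert c A) = c" "Min (insert c A) = ?m"
      using Max_insert[OF insert.hyps(1) False, of c] Min_insert[OF insert.hyps(1) False, of c] bc mb
      by linarith+
    from path[of "u ?b" "u c" ?b c] bc bA insert.prems obtain g where g:
      "g \<in> {?b..c} \<rightarrow> U" "absolutely_continuous_on {?b..c} g" "g ?b = u ?b" "g c = u c"
      "total_variation {?b..c} g \<le> ennreal (M * norm (u c - u ?b))"
      by auto
    \<comment> \<open>Both pieces take the value \<open>u ?b\<close> at \<open>?b\<close>, so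
      \<open>k\<close> agrees with \<open>g\<close> on all of the closed interval
      \<open>{?b..c}\<close>.\<close>
    define k where "k t = (if t \<le> ?b then h t else g t)" for t
    have kh: "k t = h t" if "t \<in> {?m..?b}" for t using that by (simp add: k_def)
    have kg: "k t = g t" if "t \<in> {?b..c}" for t
      using that g(3) h(3)[OF bA] by (auto simp: k_def)
    have "k \<in> {?m..c} \<rightarrow> U" using h(1) g(1) by (auto simp: k_def Pi_iff)
    moreover have "absolutely_continuous_on {?m..c} k"
      using absolutely_continuous_on_cong[OF h(2) kh] absolutely_continuous_on_cong[OF g(2) kg] mb bc
      by (intro absolutely_continuous_on_join[of ?m ?b k c]) auto
    moreover have "\<forall>t\<in>insert c A. k t = u t"
      using h(3) g(4) bc leb by (auto simp: k_def)
    moreover have "total_variation {?m..c} k \<le> ennreal M * total_variation {?m..c} u"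
    proof -
      have "total_variation {?m..c} k \<le> total_variation {?m..?b} k + total_variation {?b..c} k"
        using mb bc by (intro total_variation_join) auto
      also have "\<dots> = total_variation {?m..?b} h + total_variation {?b..c} g"
        by (simp only: total_variation_cong[OF kh] total_variation_cong[OF kg])
      also have "\<dots> \<le> ennreal M * total_variation {?m..?b} u + ennreal (M * norm (u c - u ?b))"
        using h(4) g(5) by (rule add_mono)
      also have "\<dots> = ennreal M * (total_variation {?m..?b} u + ennreal (norm (u c - u ?b)))"
        using \<open>M \<ge> 1\<close> by (simp add: distrib_left ennreal_mult)
      also have "\<dots> \<le> ennreal M * total_variation {?m..c} u"
        using mb bc by (intro mult_left_mono total_variation_add_increment_le) auto
      finally show ?thesis .
    qed
    moreover have "\<exists>x\<in>insert c A. \<exists>y\<in>insert c A. x \<le> t \<and> t \<le> y \<and> {x<..<y} \<inter> insert c A = {} \<and>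
       norm (k t - u x) \<le> M * norm (u y - u x)" if t: "t \<in> {?m..c}" for t
    proof (cases "t \<le> ?b")
      case True
      with t h(5)[of t] obtain x y where xy: "x \<in> A" "y \<in> A" "x \<le> t" "t \<le> y" "{x<..<y} \<inter> A = {}"
         "norm (h t - u x) \<le> M * norm (u y - u x)"
        by auto
      moreover have "{x<..<y} \<inter> insert c A = {}" using xy(5) leb[OF xy(2)] bc by auto
      ultimately show ?thesis using True by (auto simp: k_def)
    next
      case False
      \<comment> \<open>To the right of \<open>?b\<close> the neighbouring nodes are
        \<open>?b\<close> and \<open>c\<close>, and the path moves away from its start by at most
        its total variation.\<close>
      have "ennreal (norm (g t - g ?b)) \<le> ennreal (M * norm (u c - u ?b))"
        using norm_diff_le_total_variation[of ?b "{?b..c}" t g] g(5) t False bc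
        by (auto intro: order_trans)
      then have "norm (k t - u ?b) \<le> M * norm (u c - u ?b)"
        using False g(3) \<open>M \<ge> 1\<close> by (simp add: k_def ennreal_le_iff)
      moreover have "{?b<..<c} \<inter> insert c A = {}" using leb by force
      ultimately show ?thesis using t False bA
        by (intro bexI[of _ ?b] bexI[of _ c]) auto
    qed
    ultimately show ?thesis unfolding mx by (intro exI[of _ k]) blast
  qed
qed

section \<open>Approximation along an exhausting sequence of node sets\<close>

theorem theorem2p5:
  fixes U :: "(real ^ 'm) set" and a b :: real and u :: "real \<Rightarrow> real ^ 'm"
  assumes "compact U"
    and "pointwise_L1_ac_approximable U"
    and "whitney_property U"
    and "a \<le> b"
    and "u \<in> BV {a..b} U"
  shows "\<exists>uk :: nat \<Rightarrow> real \<Rightarrow> real ^ 'm.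
           (\<forall>k. uk k \<in> {a..b} \<rightarrow> U \<and> absolutely_continuous_on {a..b} (uk k)) \<and>
           (SUP k. total_variation {a..b} (uk k)) < \<infinity> \<and>
           (\<forall>t\<in>{a..b}. (\<lambda>k. uk k t) \<longlonglongrightarrow> u t)"
proof -
  have uU: "u \<in> {a..b} \<rightarrow> U" and fin: "total_variation {a..b} u < \<infinity>"
    using assms(5) by (auto simp: BV_def)
  obtain M where M: "M \<ge> 1" and path: "\<And>u1 u2 p q. u1 \<in> U \<Longrightarrow> u2 \<in> U \<Longrightarrow> p < q \<Longrightarrow>
      \<exists>g. g \<in> {p..q} \<rightarrow> U \<and> absolutely_continuous_on {p..q} g \<and> g p = u1 \<and> g q = u2 \<and>
          total_variation {p..q} g \<le> ennreal (M * norm (u2 - u1))"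
    using whitney_path[OF assms(3)] by blast
  obtain v :: "real \<Rightarrow> real" where
    v_ctble: "countable {t \<in> {a..b}. \<not> continuous (at t within {a..b}) v}" and
    v_bound: "\<And>s t. s \<in> {a..b} \<Longrightarrow> t \<in> {a..b} \<Longrightarrow> norm (u t - u s) \<le> \<bar>v t - v s\<bar>"
    using countable_discontinuities_variation_function[OF fin] by blast
  define D where "D = {a, b} \<union> {t \<in> {a..b}. \<not> continuous (at t within {a..b}) v} \<union> (\<rat> \<inter> {a..b})"
  have D: "countable D" "D \<noteq> {}" "D \<subseteq> {a..b}"
    using v_ctble countable_rat assms(4) by (auto simp: D_def)
  \<comment> \<open>The endpoints belong to every \<open>F k\<close>, so each interpolant lives on
    the whole of \<open>{a..b}\<close>; the enumeration of \<open>D\<close> is surjective, so every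
    point of \<open>D\<close> becomes and remains a node.\<close>
  define F where "F k = {a, b} \<union> from_nat_into D ` {..k}" for k :: nat
  have F: "finite (F k)" "F k \<noteq> {}" "F k \<subseteq> {a..b}" for k
    using D(2,3) from_nat_into[OF D(2)] assms(4) by (auto simp: F_def)
  have MinF: "Min (F k) = a" and MaxF: "Max (F k) = b" for k
  proof -
    have "a \<in> F k" "b \<in> F k" by (auto simp: F_def)
    then show "Min (F k) = a" "Max (F k) = b"
      using F(1,3)[of k] by (auto intro!: Min_eqI Max_eqI)
  qed
  have F_eventually: "\<forall>\<^sub>F k in sequentially. d \<in> F k" if d: "d \<in> D" for d
  proof -
    obtain n where "from_nat_into D n = d"
      using from_nat_into_surj[OF D(1) d] by blast
    then have "d \<in> F k" if "n \<le> k" for k using that by (auto simp: F_def)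
    then show ?thesis using eventually_ge_at_top[of n] by (rule eventually_mono[rotated])
  qed
  have "\<exists>h. h \<in> {a..b} \<rightarrow> U \<and> absolutely_continuous_on {a..b} h \<and> (\<forall>t\<in>F k. h t = u t) \<and>
    total_variation {a..b} h \<le> ennreal M * total_variation {a..b} u \<and>
    (\<forall>t\<in>{a..b}. \<exists>x\<in>F k. \<exists>y\<in>F k. x \<le> t \<and> t \<le> y \<and> {x<..<y} \<inter> F k = {} \<and>
       norm (h t - u x) \<le> M * norm (u y - u x))" for k
    using whitney_interpolation[OF M path F(1,2), of u k] uU F(3)[of k]
    unfolding MinF MaxF by blast
  then obtain uk where uk: "\<And>k. uk k \<in> {a..b} \<rightarrow> U" "\<And>k. absolutely_continuous_on {a..b} (uk k)"
    "\<And>k t. t \<in> F k \<Longrightarrow> uk k t = u t"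
    "\<And>k. total_variation {a..b} (uk k) \<le> ennreal M * total_variation {a..b} u"
    "\<And>k t. t \<in> {a..b} \<Longrightarrow> \<exists>x\<in>F k. \<exists>y\<in>F k. x \<le> t \<and> t \<le> y \<and> {x<..<y} \<inter> F k = {} \<and>
       norm (uk k t - u x) \<le> M * norm (u y - u x)"
    by metis
  have "(SUP k. total_variation {a..b} (uk k)) \<le> ennreal M * total_variation {a..b} u"
    using uk(4) by (rule SUP_least)
  also have "\<dots> < \<infinity>" using fin by (simp add: ennreal_mult_less_top)
  finally have "(SUP k. total_variation {a..b} (uk k)) < \<infinity>" .
  moreover have "(\<lambda>k. uk k t) \<longlonglongrightarrow> u t" if t: "t \<in> {a..b}" for t
  proof (cases "t \<in> D")
    case True
    have "\<forall>\<^sub>F k in sequentially. uk k t = u t"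
      using F_eventually[OF True] by eventually_elim (rule uk(3))
    then show ?thesis by (rule tendsto_eventually)
  next
    case False
    then have ab: "a < t" "t < b" and cont: "continuous (at t within {a..b}) v"
      using t by (auto simp: D_def less_le)
    show ?thesis
    proof (rule tendstoI)
      fix e :: real
      assume "e > 0"
      \<comment> \<open>The final error is below 2M\<eta> + \<eta>: the first term bounds the
        distance from \<open>uk k t\<close> to \<open>u x\<close>, the second the distance from
        \<open>u x\<close> to \<open>u t\<close>. The denominator keeps this within
        \<open>e\<close>.\<close>
      define \<eta> where "\<eta> = e / (2 * M + 2)"
      have \<eta>: "\<eta> > 0" "\<eta> * (2 * M + 2) = e" using \<open>e > 0\<close> M by (auto simp: \<eta>_def)
      from cont \<eta>(1) obtain \<delta> where \<delta>: "\<delta> > 0"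
        "\<And>s. s \<in> {a..b} \<Longrightarrow> \<bar>s - t\<bar> < \<delta> \<Longrightarrow> \<bar>v s - v t\<bar> < \<eta>"
        unfolding continuous_within_eps_delta dist_real_def by blast
      have u_near: "norm (u s - u t) < \<eta>" if "s \<in> {a..b}" "\<bar>s - t\<bar> < \<delta>" for s
        using \<delta>(2)[OF that] v_bound[OF t that(1)] by simp
      \<comment> \<open>Rationals on either side of \<open>t\<close> within \<delta> lie in
        \<open>D\<close>; once both are nodes, they trap the neighbouring nodes of \<open>t\<close>
        in the \<delta>-neighbourhood.\<close>
      obtain r1 where r1: "r1 \<in> \<rat>" "max a (t - \<delta>) < r1" "r1 < t"
        using Rats_dense_in_real[of "max a (t - \<delta>)" t] ab \<delta>(1) by auto
      obtain r2 where r2: "r2 \<in> \<rat>" "t < r2" "r2 < min b (t + \<delta>)"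
        using Rats_dense_in_real[of t "min b (t + \<delta>)"] ab \<delta>(1) by auto
      have "r1 \<in> D" "r2 \<in> D" using r1 r2 ab by (auto simp: D_def)
      then have "\<forall>\<^sub>F k in sequentially. r1 \<in> F k \<and> r2 \<in> F k"
        using F_eventually by (simp add: eventually_conj)
      then show "\<forall>\<^sub>F k in sequentially. dist (uk k t) (u t) < e"
      proof eventually_elim
        case (elim k)
        obtain x y where xy: "x \<in> F k" "y \<in> F k" "x \<le> t" "t \<le> y" "{x<..<y} \<inter> F k = {}"
          "norm (uk k t - u x) \<le> M * norm (u y - u x)"
          using uk(5)[OF t] by blast
        \<comment> \<open>Otherwise the node \<open>r1\<close> would lie strictly between
          \<open>x\<close> and \<open>t\<close>, inside the gap from \<open>x\<close> to
          \<open>y\<close> that contains no node; the bound on \<open>y\<close> is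
          symmetric.\<close>
        have "r1 \<le> x" using xy(4,5) elim r1(3) by (force simp: not_le[symmetric])
        moreover have "y \<le> r2" using xy(3,5) elim r2(2) by (force simp: not_le[symmetric])
        ultimately have near: "\<bar>x - t\<bar> < \<delta>" "\<bar>y - t\<bar> < \<delta>" using xy(3,4) r1 r2 by auto
        have ux: "norm (u x - u t) < \<eta>" and uy: "norm (u y - u t) < \<eta>"
          using u_near near xy(1,2) F(3)[of k] by auto
        have "norm (u y - u x) \<le> 2 * \<eta>"
          using norm_triangle_ineq4[of "u y - u t" "u x - u t"] ux uy by simp
        then have "M * norm (u y - u x) \<le> M * (2 * \<eta>)" using M by (intro mult_left_mono) auto
        then have "norm (uk k t - u t) < M * (2 * \<eta>) + \<eta>"
          using norm_triangle_ineq[of "uk k t - u x" "u x - u t"] xy(6) ux by simp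
        also have "\<dots> \<le> e" using \<eta> by (simp add: algebra_simps)
        finally show ?case by (simp add: dist_norm)
      qed
    qed
  qed
  ultimately show ?thesis using uk(1,2) by blast
qed

end
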